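(* Let $d$ be a positive integer and $p$ a monic polynomial of degree $d$ with moments $(m_n)_{n\ge1}$ and finite free cumulants $(\kappa_n)_{n=1}^d$ (with $\kappa_j$, $j\ge1$, the extended coefficients as in the context). Then for $n=1,\dots,d$, $$\kappa_n = \frac{(-d)^{n-1}}{(n-1)!} \sum_{\sigma \in \mathcal{P}(n)} d^{|\sigma|}\mu(0_n,\sigma)\, m_{\sigma} \sum_{\pi \geq \sigma} \frac{\mu(\pi,1_n)}{(d)_{\pi}} = \frac{(-1)^n d^{n-1}}{(n-1)!} \sum_{\sigma \in \mathcal{P}(n)} d^{|\sigma|}\mu(0_n,\sigma)\,m_{\sigma} \sum_{\pi \geq \sigma} \frac{(-1)^{| \pi |} (| \pi | -1 )!}{(d)_{\pi}},$$ and for all $n\in\mathbb{N}$, $$m_n = \frac{(-1)^n}{d^{n+1}(n-1)!} \sum_{\sigma \in \mathcal{P}(n)}d^{|\sigma|}\mu(0_n,\sigma)\,\kappa_\sigma \sum_{\pi \geq \sigma}\big(- \mu(\pi,1_n)\big) (d)_\pi = \frac{(-1)^n}{d^{n+1}(n-1)!} \sum_{\sigma \in \mathcal{P}(n)}d^{|\sigma|}\mu(0_n,\sigma)\,\kappa_\sigma \sum_{\pi \geq \sigma} (-1)^{| \pi |} (d)_\pi\,(| \pi | -1)!.$$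
   Context: For a monic polynomial $p$ of degree $d$ write $p(x)=\sum_{i=0}^d (-1)^i a_i x^{d-i}$ ($a_0=1$). Let $(d)_i=d(d-1)\cdots(d-i+1)$, $(d)_0=1$. Define $\kappa_j$ ($j\ge1$) by the formal power series identity $$-\frac{1}{d}\frac{\partial}{\partial s}\ln\Big(\sum_{i=0}^d \frac{(-d)^i a_i}{(d)_i}s^i\Big)=\sum_{j\ge 0}\kappa_{j+1}s^j ;$$ $\kappa_1,\dots,\kappa_d$ are the finite free cumulants of $p$. If $p(x)=(x-r_1)\cdots(x-r_d)$, its moments are $m_n=\frac1d\sum_i r_i^n$. $\mathcal{P}(n)$ is the set of partitions of $\{1,\dots,n\}$ ordered by refinement ($\pi\le\sigma$ iff each block of $\pi$ lies in a block of $\sigma$), with minimum $0_n$ and maximum $1_n$; $|\pi|$ is the number of blocks. For a sequence $(f_k)$, $f_\pi=\prod_{V\in\pi}f_{|V|}$; in particular $(d)_\pi=\prod_{V\in\pi}(d)_{|V|}$. The Möbius function satisfies $\mu(0_n,\sigma)=(-1)^{n-|\sigma|}\prod_{V\in\sigma}(|V|-1)!$ and $\mu(\pi,1_n)=(-1)^{|\pi|-1}(|\pi|-1)!$. *)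

theory Defs
  imports
    Complex_Main
    "HOL-Library.Disjoint_Sets"
    "HOL-Computational_Algebra.Computational_Algebra"
begin

definition falling :: "nat \<Rightarrow> nat \<Rightarrow> complex" where
  "falling d i = (\<Prod>k<i. of_nat d - of_nat k)"

text \<open>The \<open>a\<^sub>i\<close> of \<open>p(x) = \<Sum>i\<le>d. (-1)^i a\<^sub>i x^(d-i)\<close> with \<open>d = degree p\<close>; only used for \<open>i \<le> d\<close>.\<close>

definition signed_coeff :: "complex poly \<Rightarrow> nat \<Rightarrow> complex" where
  "signed_coeff p i = (-1) ^ i * coeff p (degree p - i)"

definition cumulant_series :: "complex poly \<Rightarrow> complex fps" where
  "cumulant_series p =
    (\<Sum>i=0..degree p.
       fps_const ((- of_nat (degree p)) ^ i * signed_coeff p i / falling (degree p) i) * fps_X ^ i)"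

text \<open>The formal logarithm of a series with constant coefficient 1; \<^term>\<open>fps_ln 1\<close> is the
  series of \<open>ln (1 + X)\<close>.\<close>

definition fps_log :: "complex fps \<Rightarrow> complex fps" where
  "fps_log F = fps_compose (fps_ln 1) (F - 1)"

text \<open>Defined for all \<open>j \<ge> 1\<close>, including \<open>j > degree p\<close>; the value at 0 has no meaning.\<close>

definition finite_free_cumulant :: "complex poly \<Rightarrow> nat \<Rightarrow> complex" where
  "finite_free_cumulant p j =
    fps_nth (fps_const (- 1 / of_nat (degree p)) * fps_deriv (fps_log (cumulant_series p))) (j - 1)"

definition poly_moment :: "complex poly \<Rightarrow> nat \<Rightarrow> complex" where
  "poly_moment p n = (\<Sum>r\<in>#proots p. r ^ n) / of_nat (degree p)"

definition set_partitions :: "nat \<Rightarrow> nat set set set" where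
  "set_partitions n = {\<sigma>. partition_on {1..n} \<sigma>}"

definition partition_le :: "nat \<Rightarrow> nat set set \<Rightarrow> nat set set \<Rightarrow> bool" where
  "partition_le n \<pi> \<sigma> \<longleftrightarrow> refines {1..n} \<pi> \<sigma>"

definition min_partition :: "nat \<Rightarrow> nat set set" where
  "min_partition n = (\<lambda>i. {i}) ` {1..n}"

text \<open>For \<open>n = 0\<close> this is not a partition, as its only block would be empty.\<close>

definition max_partition :: "nat \<Rightarrow> nat set set" where
  "max_partition n = {{1..n}}"

definition block_prod :: "(nat \<Rightarrow> complex) \<Rightarrow> nat set set \<Rightarrow> complex" where
  "block_prod f \<pi> = (\<Prod>V\<in>\<pi>. f (card V))"

text \<open>The Moebius function of the refinement order on the partitions of \<open>{1..n}\<close>, by the usual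
  recursion; it is 0 on pairs that are not comparable.\<close>

function partition_mobius :: "nat \<Rightarrow> nat set set \<Rightarrow> nat set set \<Rightarrow> int" where
  "partition_mobius n \<pi> \<sigma> =
    (if \<not> partition_le n \<pi> \<sigma> then 0
     else if \<pi> = \<sigma> then 1
     else - (\<Sum>\<rho> | partition_le n \<pi> \<rho> \<and> partition_le n \<rho> \<sigma> \<and> \<rho> \<noteq> \<sigma>. partition_mobius n \<pi> \<rho>))"
  by pat_completeness auto
termination
proof (relation "measure (\<lambda>(n, \<pi>, \<sigma>). card {\<tau>. partition_le n \<pi> \<tau> \<and> partition_le n \<tau> \<sigma>})",
    goal_cases)
  case (2 n \<pi> \<sigma> \<rho>)
  let ?I = "\<lambda>\<sigma>. {\<tau>. partition_le n \<pi> \<tau> \<and> partition_le n \<tau> \<sigma>}"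
  have le: "partition_le n \<pi> \<rho>" "partition_le n \<rho> \<sigma>" and ne: "\<rho> \<noteq> \<sigma>"
    using 2(3) by auto
  have "?I \<sigma> \<subseteq> Pow (Pow {1..n})"
    by (auto simp: partition_le_def refines_def partition_on_def)
  then have fin: "finite (?I \<sigma>)"
    by (rule finite_subset) simp
  have sub: "?I \<rho> \<subseteq> ?I \<sigma>"
    using le(2) unfolding partition_le_def by (blast intro: refines_trans)
  have "\<sigma> \<in> ?I \<sigma>"
    using le unfolding partition_le_def
    by (auto intro: refines_trans refines_refl simp: refines_def[of _ \<rho> \<sigma>])
  moreover have "\<sigma> \<notin> ?I \<rho>"
    using le(2) ne unfolding partition_le_def by (blast dest: refines_asym)
  ultimately have "?I \<rho> \<subset> ?I \<sigma>"
    using sub by blast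
  then show ?case
    using fin by (simp add: psubset_card_mono)
qed simp

declare partition_mobius.simps [simp del]

end

theory Submission
  imports Defs
begin

text \<open>
  Exchanging the two sums, the inner sum over all \<open>\<sigma> \<le> \<pi>\<close> factors over the blocks of \<open>\<pi>\<close>, and the
  compositional formula for exponential generating functions turns the double sum into
  \<open>n! [x^n] log (\<Sum>k. w\<^sub>k E\<^sub>k x^k)\<close> with \<open>E = exp (\<Sum>j. (-1)^(j-1) d f\<^sub>j x^j / j)\<close>, because the Moebius
  function supplies the coefficients of \<open>log (1 + x)\<close>. For the moments \<open>f = m\<close> we get
  \<open>E = \<Prod>i. 1 + r\<^sub>i x = \<Sum>k. a\<^sub>k x^k\<close>, and dividing by \<open>(d)\<^sub>k\<close> gives the cumulant series up to
  the scaling \<open>x \<mapsto> -d x\<close>. For \<open>f = \<kappa>\<close> we get the cumulant series at \<open>-x\<close>, and multiplying by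
  \<open>(d)\<^sub>k\<close> leads back to \<open>\<Prod>i. 1 + r\<^sub>i x\<close> at \<open>d x\<close>, whose logarithm has the power sums as
  coefficients.
\<close>

subsection \<open>Formal logarithms\<close>

lemma fps_log_nth_0 [simp]: "fps_log F $ 0 = 0"
  by (simp add: fps_log_def)

text \<open>Chain rule: the derivative of \<open>fps_ln 1\<close> times \<open>1 + fps_X\<close> is
  1, and composing with \<open>F - 1\<close> turns \<open>1 + fps_X\<close> into \<open>F\<close>.
  The product form avoids dividing by \<open>F\<close>.\<close>

lemma fps_deriv_fps_log:
  assumes "F $ 0 = 1"
  shows "fps_deriv (fps_log F) * F = fps_deriv F"
proof -
  have 0: "(F - 1) $ 0 = 0"
    using assms by simp
  have "fps_deriv (fps_ln 1) * (1 + fps_X) = (1 :: complex fps)"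
    by (simp add: fps_ln_deriv inverse_mult_eq_1)
  then have "(fps_deriv (fps_ln 1) * (1 + fps_X)) oo (F - 1) = 1"
    by simp
  then have "(fps_deriv (fps_ln 1) oo (F - 1)) * F = 1"
    using 0 by (simp add: fps_compose_mult_distrib[OF 0] fps_compose_add_distrib)
  moreover have "fps_deriv (fps_log F) = (fps_deriv (fps_ln 1) oo (F - 1)) * fps_deriv F"
    unfolding fps_log_def using fps_compose_deriv[OF 0] by simp
  ultimately show ?thesis
    by (metis mult.assoc mult.commute mult.right_neutral)
qed

text \<open>In characteristic 0 the derivative and the constant term determine a series; the factor
  \<open>F\<close> cancels because it is nonzero.\<close>

lemma fps_log_unique:
  assumes "F $ 0 = 1" "L $ 0 = 0" "fps_deriv F = fps_deriv L * F"
  shows "fps_log F = L"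
proof -
  have "F \<noteq> 0"
    using assms(1) by auto
  moreover have "fps_deriv (fps_log F) * F = fps_deriv L * F"
    using fps_deriv_fps_log[OF assms(1)] assms(3) by simp
  ultimately have "fps_deriv (fps_log F) = fps_deriv L"
    by simp
  then show ?thesis
    using assms(2) by (simp add: fps_deriv_eq_iff)
qed

lemma fps_log_1 [simp]: "fps_log 1 = 0"
  by (simp add: fps_log_def)

text \<open>By the product rule, the sum of the logarithms has the logarithmic derivative of
  \<open>F * G\<close>.\<close>

lemma fps_log_mult:
  assumes "F $ 0 = 1" "G $ 0 = 1"
  shows "fps_log (F * G) = fps_log F + fps_log G"
proof (rule fps_log_unique)
  show "fps_deriv (F * G) = fps_deriv (fps_log F + fps_log G) * (F * G)"
    using fps_deriv_fps_log[OF assms(1)] fps_deriv_fps_log[OF assms(2)]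
    by (simp add: algebra_simps)
qed (use assms in auto)

lemma fps_log_linear:
  assumes "n > 0"
  shows "fps_log (1 + fps_const r * fps_X) $ n = (-1) ^ (n - 1) * r ^ n / of_nat n"
  using assms by (simp add: fps_log_def fps_compose_linear fps_ln_nth)

lemma fps_log_compose:
  assumes "F $ 0 = 1" "G $ 0 = 0"
  shows "fps_log (F oo G) = fps_log F oo G"
  using fps_compose_assoc[of G "F - 1" "fps_ln 1"] assms
  by (simp add: fps_log_def fps_compose_sub_distrib)

text \<open>\<open>fps_ln 1\<close> is the compositional inverse of
  \<open>fps_exp 1 - 1\<close>.\<close>

lemma fps_exp_compose_ln: "fps_exp 1 oo fps_ln 1 = (1 + fps_X :: 'a :: field_char_0 fps)"
proof -
  have "(fps_exp 1 - 1) oo fps_ln 1 = (fps_X :: 'a fps)"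
    unfolding fps_ln_fps_exp_inv[of 1, simplified] by (rule fps_inv_fps_exp_compose) simp
  then show ?thesis
    by (simp add: fps_compose_sub_distrib algebra_simps)
qed

lemma fps_exp_compose_log:
  assumes "F $ 0 = 1"
  shows "fps_exp 1 oo fps_log F = F"
  using assms unfolding fps_log_def
  by (simp add: fps_compose_assoc fps_exp_compose_ln fps_compose_add_distrib)

subsection \<open>The compositional formula\<close>

definition egf :: "(nat \<Rightarrow> 'a) \<Rightarrow> 'a :: field_char_0 fps" where
  "egf f = Abs_fps (\<lambda>k. f k / fact k)"

text \<open>The blocks of a partition are nonempty, so that the value of a block weight at 0 is irrelevant.\<close>

definition egf0 :: "(nat \<Rightarrow> 'a) \<Rightarrow> 'a :: field_char_0 fps" where
  "egf0 f = egf (f(0 := 0))"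

lemma egf_nth [simp]: "egf f $ k = f k / fact k"
  by (simp add: egf_def)

lemma egf0_nth: "egf0 f $ k = (if k = 0 then 0 else f k / fact k)"
  by (simp add: egf0_def)

lemma egf0_nth_0 [simp]: "egf0 f $ 0 = 0"
  by (simp add: egf0_nth)

section \<open>Sums of block-multiplicative weights over the partitions of a finite set\<close>

lemma sum_Pow_card:
  fixes h :: "nat \<Rightarrow> 'a :: comm_semiring_1"
  assumes "finite B"
  shows "(\<Sum>T\<in>Pow B. h (card T)) = (\<Sum>j\<le>card B. of_nat (card B choose j) * h j)"
proof -
  have "(\<Sum>T\<in>Pow B. h (card T)) = (\<Sum>j\<le>card B. \<Sum>T | T \<in> Pow B \<and> card T = j. h (card T))"
    using assms by (intro sum.group [symmetric]) (auto intro: card_mono)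
  also have "\<dots> = (\<Sum>j\<le>card B. of_nat (card B choose j) * h j)"
    using assms by (intro sum.cong) (auto simp: n_subsets Pow_def)
  finally show ?thesis .
qed

lemma finite_block: "partition_on A P \<Longrightarrow> finite A \<Longrightarrow> V \<in> P \<Longrightarrow> finite V"
  by (auto simp: partition_on_def intro: finite_subset)

lemma card_partition_le:
  assumes "finite A" "partition_on A P"
  shows "card P \<le> card A"
proof -
  have "(\<Sum>V\<in>P. 1) \<le> (\<Sum>V\<in>P. card V)"
    using assms finite_block[OF assms(2,1)]
    by (intro sum_mono) (auto simp: Suc_le_eq card_gt_0_iff dest: partition_onD3)
  then show ?thesis
    using product_partition[OF assms(2)] finite_block[OF assms(2,1)] by simp
qed

text \<open>The removal of the block of \<open>a\<close>, as an equivalence. The clause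
  \<open>insert a T \<notin> Q\<close> makes sure that the insertion really adds a block.\<close>

lemma partition_insert_block_iff:
  assumes "a \<in> A" "T \<subseteq> A - {a}"
  shows "partition_on (A - {a} - T) Q \<longleftrightarrow>
    insert a T \<notin> Q \<and> partition_on A (insert (insert a T) Q)"
  (is "?l \<longleftrightarrow> ?r")
proof
  assume l: ?l
  then have "disjnt (insert a T) (\<Union>Q)"
    by (auto simp: partition_on_def disjnt_def)
  moreover have "A - insert a T = A - {a} - T"
    by auto
  moreover have "insert a T \<notin> Q"
    using l by (auto simp: partition_on_def)
  ultimately show ?r
    using l assms partition_on_insert[of "insert a T" Q A] by auto
next
  assume r: ?r
  have "disjnt (insert a T) V" if "V \<in> Q" for V
  proof -
    have "V \<noteq> insert a T" "disjoint (insert (insert a T) Q)"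
      using that r partition_onD2 by metis+
    then show ?thesis
      using that unfolding pairwise_def by (metis insert_iff)
  qed
  then have "disjnt (insert a T) (\<Union>Q)"
    unfolding disjnt_def by blast
  moreover have "A - insert a T = A - {a} - T"
    by (rule Diff_insert2)
  ultimately show ?l
    using r partition_on_insert[of "insert a T" Q A] by metis
qed

text \<open>Recursion on the block containing the fixed point \<open>a\<close>: it has the form
  \<open>insert a T\<close>, and the other \<open>k\<close> blocks partition what is left.\<close>

lemma sum_partitions_insert:
  fixes g :: "nat \<Rightarrow> 'a :: field_char_0"
  assumes fin: "finite A" and a: "a \<in> A"
  shows "(\<Sum>P | partition_on A P \<and> card P = Suc k. \<Prod>V\<in>P. g (card V)) =
    (\<Sum>T\<in>Pow (A - {a}). g (Suc (card T)) *
      (\<Sum>Q | partition_on (A - {a} - T) Q \<and> card Q = k. \<Prod>V\<in>Q. g (card V)))"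
proof -
  define X where "X T = {Q. partition_on (A - {a} - T) Q \<and> card Q = k}" for T
  define Y where "Y = {P. partition_on A P \<and> card P = Suc k}"
  \<comment> \<open>The unique block of \<open>P\<close> that contains \<open>a\<close>; it provides
    the inverse of adding the block \<open>insert a T\<close>.\<close>
  define b where "b P = (THE V. V \<in> P \<and> a \<in> V)" for P
  have finX: "finite (X T)" for T
    unfolding X_def using finitely_many_partition_on[of "A - {a} - T"] fin
    by (auto intro: finite_subset)
  have b: "b P \<in> P" "a \<in> b P" if "partition_on A P" for P
  proof -
    have "\<exists>!V. V \<in> P \<and> a \<in> V"
      using that a by (auto simp: partition_on_def disjoint_def)
    then have "b P \<in> P \<and> a \<in> b P"
      unfolding b_def by (rule theI')
    then show "b P \<in> P" "a \<in> b P"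
      by auto
  qed
  have b_eq: "b P = V" if "partition_on A P" "V \<in> P" "a \<in> V" for P V
    using b[OF that(1)] that by (auto simp: partition_on_def disjoint_def)
  have finQ: "finite Q" if "T \<subseteq> A - {a}" "Q \<in> X T" for T Q
    using that fin finite_elements[of "A - {a} - T"] by (auto simp: X_def)
  have "(\<Sum>T\<in>Pow (A - {a}). g (Suc (card T)) * (\<Sum>Q\<in>X T. \<Prod>V\<in>Q. g (card V))) =
    (\<Sum>(T, Q)\<in>Sigma (Pow (A - {a})) X. g (Suc (card T)) * (\<Prod>V\<in>Q. g (card V)))"
    using fin finX by (simp add: sum_distrib_left sum.Sigma)
  also have "\<dots> = (\<Sum>P\<in>Y. \<Prod>V\<in>P. g (card V))"
  proof (rule sum.reindex_bij_witness[where
        i = "\<lambda>P. (b P - {a}, P - {b P})" and j = "\<lambda>(T, Q). insert (insert a T) Q"], goal_cases)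
    case (1 x)
    then obtain T Q where x: "x = (T, Q)" "T \<subseteq> A - {a}" "Q \<in> X T"
      by auto
    then have *: "insert a T \<notin> Q" "partition_on A (insert (insert a T) Q)"
      using partition_insert_block_iff[OF a, of T Q] by (auto simp: X_def)
    then have "b (insert (insert a T) Q) = insert a T"
      by (intro b_eq) auto
    then show ?case
      using x * by auto
  next
    case (2 x)
    then obtain T Q where x: "x = (T, Q)" "T \<subseteq> A - {a}" "Q \<in> X T"
      by auto
    then show ?case
      using finQ[OF x(2,3)] partition_insert_block_iff[OF a, of T Q] by (auto simp: X_def Y_def)
  next
    case (3 P)
    then show ?case
      using b[of P] by (auto simp: Y_def insert_absorb)
  next
    case (4 P)
    then have P: "partition_on A P" "card P = Suc k" and "finite P"
      using fin by (auto simp: Y_def intro: finite_elements)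
    have sub: "b P - {a} \<subseteq> A - {a}"
      using b[OF P(1)] P(1) by (auto simp: partition_on_def)
    have "insert a (b P - {a}) = b P"
      using b[OF P(1)] by auto
    then have "partition_on (A - {a} - (b P - {a})) (P - {b P})"
      using partition_insert_block_iff[OF a sub, of "P - {b P}"] P b[OF P(1)]
      by (simp add: insert_absorb)
    then show ?case
      using sub P b[OF P(1)] \<open>finite P\<close> by (auto simp: X_def)
  next
    case (5 x)
    then obtain T Q where x: "x = (T, Q)" "T \<subseteq> A - {a}" "Q \<in> X T"
      by auto
    then have "insert a T \<notin> Q" "finite T" "a \<notin> T"
      using partition_insert_block_iff[OF a, of T Q] fin
      by (auto simp: X_def intro: finite_subset)
    then show ?case
      using x finQ[OF x(2,3)] by simp
  qed
  finally show ?thesis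
    by (simp add: X_def Y_def)
qed

text \<open>A partition into \<open>k\<close> blocks is an unordered choice of \<open>k\<close>
  blocks, hence the \<open>k\<close>-th power over \<open>k!\<close>. The recursion on the block of
  \<open>a\<close> mirrors the power rule for \<open>?G ^ Suc k\<close>.\<close>

lemma sum_partitions_card:
  fixes g :: "nat \<Rightarrow> 'a :: field_char_0"
  assumes "finite A"
  shows "(\<Sum>P | partition_on A P \<and> card P = k. \<Prod>V\<in>P. g (card V)) =
    fact (card A) / fact k * (egf0 g ^ k) $ card A"
  using assms
proof (induction k arbitrary: A)
  case 0
  have "{P. partition_on A P \<and> card P = 0} = (if A = {} then {{}} else {})"
    using 0 finite_elements[OF 0] by (auto simp: partition_on_empty) (auto simp: partition_on_def)
  then show ?case
    using 0 by (auto simp: sum.neutral split: if_splits)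
next
  case (Suc k)
  show ?case
  proof (cases "A = {}")
    case True
    then have none: "{P. partition_on A P \<and> card P = Suc k} = {}"
      by (auto simp: partition_on_empty)
    show ?thesis
      unfolding none using True by simp
  next
    case False
    then obtain a where a: "a \<in> A"
      by auto
    define n where "n = card (A - {a})"
    have n: "card A = Suc n"
      using a Suc.prems card_Suc_Diff1[of A a] by (simp add: n_def)
    let ?G = "egf0 g"
    have "(\<Sum>P | partition_on A P \<and> card P = Suc k. \<Prod>V\<in>P. g (card V)) =
      (\<Sum>T\<in>Pow (A - {a}). g (Suc (card T)) *
        (\<Sum>Q | partition_on (A - {a} - T) Q \<and> card Q = k. \<Prod>V\<in>Q. g (card V)))"
      by (rule sum_partitions_insert[OF Suc.prems a])
    also have "\<dots> = (\<Sum>T\<in>Pow (A - {a}). g (Suc (card T)) *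
        (fact (n - card T) / fact k * (?G ^ k) $ (n - card T)))"
    proof (rule sum.cong[OF refl])
      fix T assume T: "T \<in> Pow (A - {a})"
      then have "card (A - {a} - T) = n - card T"
        using Suc.prems by (simp add: n_def card_Diff_subset finite_subset)
      then show "g (Suc (card T)) *
          (\<Sum>Q | partition_on (A - {a} - T) Q \<and> card Q = k. \<Prod>V\<in>Q. g (card V)) =
          g (Suc (card T)) * (fact (n - card T) / fact k * (?G ^ k) $ (n - card T))"
        using Suc by simp
    qed
    also have "\<dots> = (\<Sum>j\<le>n. of_nat (n choose j) *
        (g (Suc j) * (fact (n - j) / fact k * (?G ^ k) $ (n - j))))"
      unfolding n_def using Suc.prems by (subst sum_Pow_card) auto
    \<comment> \<open>The binomial coefficient turns the sum into a Cauchy product. The block of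
      \<open>a\<close> has \<open>Suc j\<close> elements but only \<open>j\<close> of them are
      chosen, which produces the derivative of \<open>?G\<close>.\<close>
    also have "\<dots> = (\<Sum>j\<le>n. fact n / fact k * (fps_deriv ?G $ j * (?G ^ k) $ (n - j)))"
    proof (intro sum.cong refl)
      fix j assume "j \<in> {..n}"
      then have c: "of_nat (n choose j) * fact (n - j) = (fact n / fact j :: 'a)"
        by (simp add: binomial_fact)
      have "of_nat (n choose j) * (g (Suc j) * (fact (n - j) / fact k * (?G ^ k) $ (n - j))) =
          (of_nat (n choose j) * fact (n - j)) * (g (Suc j) / fact k * (?G ^ k) $ (n - j))"
        by simp
      also have "\<dots> = fact n / fact k * ((g (Suc j) / fact j) * (?G ^ k) $ (n - j))"
        unfolding c by simp
      also have "g (Suc j) / fact j = fps_deriv ?G $ j"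
        by (simp add: egf0_nth field_simps del: of_nat_Suc)
      finally show "of_nat (n choose j) *
          (g (Suc j) * (fact (n - j) / fact k * (?G ^ k) $ (n - j))) =
          fact n / fact k * (fps_deriv ?G $ j * (?G ^ k) $ (n - j))" .
    qed
    also have "\<dots> = fact n / fact k * (fps_deriv ?G * ?G ^ k) $ n"
      by (simp add: fps_mult_nth sum_distrib_left atMost_atLeast0)
    also have "(fps_deriv ?G * ?G ^ k) $ n = (fps_deriv (?G ^ Suc k)) $ n / of_nat (Suc k)"
      by (simp add: fps_deriv_power mult.assoc del: power_Suc of_nat_Suc)
    also have "fact n / fact k * \<dots> = fact (card A) / fact (Suc k) * (?G ^ Suc k) $ card A"
      by (simp add: n field_simps del: power_Suc)
    finally show ?thesis .
  qed
qed

text \<open>There are at most \<open>card A\<close> blocks, so grouping by their number gives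
  exactly the finite sum that defines a coefficient of the composition.\<close>

lemma sum_partitions_compose:
  fixes g h :: "nat \<Rightarrow> 'a :: field_char_0"
  assumes "finite A"
  shows "(\<Sum>P | partition_on A P. h (card P) * (\<Prod>V\<in>P. g (card V))) =
    fact (card A) * (egf h oo egf0 g) $ card A"
proof -
  let ?\<P> = "{P. partition_on A P}"
  have "(\<Sum>P\<in>?\<P>. h (card P) * (\<Prod>V\<in>P. g (card V))) =
    (\<Sum>k\<in>{0..card A}. \<Sum>P | P \<in> ?\<P> \<and> card P = k. h (card P) * (\<Prod>V\<in>P. g (card V)))"
    using assms card_partition_le[OF assms]
    by (intro sum.group [symmetric] finitely_many_partition_on) auto
  also have "\<dots> = (\<Sum>k\<in>{0..card A}. h k * (\<Sum>P | partition_on A P \<and> card P = k. \<Prod>V\<in>P. g (card V)))"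
    by (auto simp: sum_distrib_left intro!: sum.cong)
  also have "\<dots> = fact (card A) * (egf h oo egf0 g) $ card A"
    by (simp add: sum_partitions_card assms fps_compose_nth sum_distrib_left mult_ac)
  finally show ?thesis .
qed

text \<open>The exponential formula: outer weight 1.\<close>

lemma sum_partitions_exp:
  fixes g :: "nat \<Rightarrow> 'a :: field_char_0"
  assumes "finite A"
  shows "(\<Sum>P | partition_on A P. \<Prod>V\<in>P. g (card V)) =
    fact (card A) * (fps_exp 1 oo egf0 g) $ card A"
proof -
  have "egf (\<lambda>_. 1) = (fps_exp 1 :: 'a fps)"
    by (simp add: fps_eq_iff)
  then show ?thesis
    using sum_partitions_compose[OF assms, of "\<lambda>_. 1" g] by simp
qed

subsection \<open>Refinements\<close>

text \<open>A refinement of \<open>P\<close> is an independent choice of a partition of each block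
  of \<open>P\<close>, so distributivity turns the sum into a product.\<close>

lemma sum_refinements:
  fixes f :: "'a set \<Rightarrow> 'b :: comm_semiring_1"
  assumes fin: "finite A" and P: "partition_on A P"
  shows "(\<Sum>Q | refines A Q P. \<Prod>V\<in>Q. f V) = (\<Prod>U\<in>P. \<Sum>T | partition_on U T. \<Prod>V\<in>T. f V)"
proof -
  have finP: "finite P" and finU: "\<And>U. U \<in> P \<Longrightarrow> finite U"
    using finite_elements[OF fin P] finite_block[OF P fin] by auto
  have disj: "\<And>U V. U \<in> P \<Longrightarrow> V \<in> P \<Longrightarrow> U \<inter> V \<noteq> {} \<Longrightarrow> U = V"
    using P by (auto simp: partition_on_def disjoint_def)
  let ?F = "PiE P (\<lambda>U. {T. partition_on U T})"
  have sub: "V \<subseteq> U" "V \<noteq> {}" if "t \<in> ?F" "U \<in> P" "V \<in> t U" for t U V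
    using that by (fastforce simp: PiE_iff partition_on_def)+
  \<comment> \<open>The choice function can be read off from the union: a nonempty \<open>V\<close>
    in \<open>t U'\<close> with \<open>V \<subseteq> U\<close> makes \<open>U\<close> and
    \<open>U'\<close> meet, hence coincide.\<close>
  have restr: "{V \<in> \<Union>(t ` P). V \<subseteq> U} = t U" if t: "t \<in> ?F" and U: "U \<in> P" for t U
  proof (intro set_eqI iffI)
    fix V assume "V \<in> {V \<in> \<Union>(t ` P). V \<subseteq> U}"
    then obtain U' where U': "U' \<in> P" "V \<in> t U'" "V \<subseteq> U"
      by auto
    then show "V \<in> t U"
      using sub[OF t U'(1,2)] disj[OF U'(1) U] by auto
  qed (use sub[OF t U] U in auto)
  have part: "refines A (\<Union>(t ` P)) P" if t: "t \<in> ?F" for t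
  proof -
    have pt: "\<And>U. U \<in> P \<Longrightarrow> partition_on U (t U)"
      using t by auto
    have "partition_on A (\<Union>(t ` P))"
    proof (rule partition_onI)
      have "\<Union>(\<Union>(t ` P)) = (\<Union>U\<in>P. \<Union>(t U))"
        by auto
      also have "\<dots> = A"
        using pt P by (auto simp: partition_on_def)
      finally show "\<Union>(\<Union>(t ` P)) = A" .
    next
      fix V W assume "V \<in> \<Union>(t ` P)" "W \<in> \<Union>(t ` P)" and ne: "V \<noteq> W"
      then obtain U U' where U: "U \<in> P" "V \<in> t U" "U' \<in> P" "W \<in> t U'"
        by auto
      show "disjnt V W"
      proof (cases "U = U'")
        case True
        then show ?thesis
          using pt[OF U(1)] U ne by (auto simp: partition_on_def pairwise_def)
      next
        case False
        then show ?thesis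
          using sub[OF t U(1,2)] sub[OF t U(3,4)] disj[OF U(1,3)] by (auto simp: disjnt_def)
      qed
    qed (use sub[OF t] in blast)
    then show ?thesis
      using P sub[OF t] unfolding refines_def by blast
  qed
  have "(\<Prod>U\<in>P. \<Sum>T | partition_on U T. \<Prod>V\<in>T. f V) = (\<Sum>t\<in>?F. \<Prod>U\<in>P. \<Prod>V\<in>t U. f V)"
    using finP finU by (intro prod_sum_PiE finitely_many_partition_on)
  also have "\<dots> = (\<Sum>Q | refines A Q P. \<Prod>V\<in>Q. f V)"
  proof (rule sum.reindex_bij_witness[where
        i = "\<lambda>Q. \<lambda>U\<in>P. {V \<in> Q. V \<subseteq> U}" and j = "\<lambda>t. \<Union>(t ` P)"], goal_cases)
    case (1 t)
    then show ?case
      using restr[OF 1] by (auto simp: restrict_def PiE_iff extensional_def fun_eq_iff)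
  next
    case (2 t)
    then show ?case
      using part by simp
  next
    case (3 Q)
    then show ?case
      by (auto simp: refines_def)
  next
    case (4 Q)
    then show ?case
      using refines_obtains_subset[of A Q P] by auto
  next
    case (5 t)
    have "(\<Prod>V\<in>\<Union>(t ` P). f V) = (\<Prod>U\<in>P. \<Prod>V\<in>t U. f V)"
    \<comment> \<open>The families \<open>t U\<close> share no member, since such a member would be
      a nonempty subset of two disjoint blocks.\<close>
    proof (rule prod.UNION_disjoint[OF finP])
      show "\<forall>U\<in>P. finite (t U)"
        using 5 finU by (auto intro: finite_elements)
      show "\<forall>U\<in>P. \<forall>V\<in>P. U \<noteq> V \<longrightarrow> t U \<inter> t V = {}"
      proof (intro ballI impI, rule ccontr)
        fix U V assume UV: "U \<in> P" "V \<in> P" "U \<noteq> V" "t U \<inter> t V \<noteq> {}"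
        then obtain X where X: "X \<in> t U" "X \<in> t V"
          by auto
        then have "X \<subseteq> U \<inter> V" "X \<noteq> {}"
          using sub[OF 5 UV(1) X(1)] sub[OF 5 UV(2) X(2)] by auto
        then show False
          using disj[OF UV(1,2)] UV(3) by blast
      qed
    qed
    then show ?case
      by simp
  qed
  finally show ?thesis
    by simp
qed

text \<open>Replacing each block of a partition coarser than \<open>P\<close> by the set of
  \<open>P\<close>-blocks inside it identifies the partitions above \<open>P\<close> with the
  partitions of the set \<open>P\<close>; the inverse takes unions.\<close>

definition blocks_in :: "'a set set \<Rightarrow> 'a set \<Rightarrow> 'a set set" where
  "blocks_in P W = {B \<in> P. B \<subseteq> W}"

lemma Union_blocks_in:
  assumes "refines A P Q" "W \<in> Q"
  shows "\<Union>(blocks_in P W) = W"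
  using partition_onD1[OF refines_obtains_subset[OF assms]] by (simp add: blocks_in_def)

text \<open>A block of \<open>P\<close> inside the union of \<open>X\<close> is nonempty, so it
  meets a member of \<open>X\<close> and equals it by disjointness.\<close>

lemma blocks_in_Union:
  assumes "partition_on A P" "X \<subseteq> P"
  shows "blocks_in P (\<Union>X) = X"
proof
  show "blocks_in P (\<Union>X) \<subseteq> X"
  proof
    fix B assume B: "B \<in> blocks_in P (\<Union>X)"
    then have "B \<in> P" "B \<subseteq> \<Union>X" "B \<noteq> {}"
      using assms(1) by (auto simp: blocks_in_def partition_on_def)
    then obtain C where C: "C \<in> X" "B \<inter> C \<noteq> {}"
      by blast
    then have "B = C"
      using disjointD[OF partition_onD2[OF assms(1)] \<open>B \<in> P\<close>] assms(2) by blast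
    then show "B \<in> X"
      using C by simp
  qed
qed (use assms(2) in \<open>auto simp: blocks_in_def\<close>)

lemma blocks_in_subset_iff:
  assumes "refines A P Q" "refines A P S" "V \<in> Q" "W \<in> S"
  shows "blocks_in P V \<subseteq> blocks_in P W \<longleftrightarrow> V \<subseteq> W"
proof
  assume "blocks_in P V \<subseteq> blocks_in P W"
  then have "\<Union>(blocks_in P V) \<subseteq> \<Union>(blocks_in P W)"
    by (rule Union_mono)
  then show "V \<subseteq> W"
    using Union_blocks_in[OF assms(1,3)] Union_blocks_in[OF assms(2,4)] by simp
qed (auto simp: blocks_in_def)

text \<open>One direction of the correspondence; \<open>refines_image_Union\<close> is the other.
  Disjoint blocks of \<open>Q\<close> cannot both contain the same nonempty block of
  \<open>P\<close>.\<close>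

lemma partition_on_blocks_in:
  assumes "refines A P Q"
  shows "partition_on P (blocks_in P ` Q)"
proof (rule partition_onI)
  show "\<Union>(blocks_in P ` Q) = P"
    using assms by (auto simp: blocks_in_def refines_def)
  show "{} \<notin> blocks_in P ` Q"
  proof
    assume "{} \<in> blocks_in P ` Q"
    then obtain W where W: "W \<in> Q" "blocks_in P W = {}"
      by auto
    then have "W = {}"
      using Union_blocks_in[OF assms W(1)] by simp
    then show False
      using W assms by (auto simp: refines_def partition_on_def)
  qed
next
  fix X Y assume "X \<in> blocks_in P ` Q" "Y \<in> blocks_in P ` Q" "X \<noteq> Y"
  then obtain V W where VW: "V \<in> Q" "W \<in> Q" "X = blocks_in P V" "Y = blocks_in P W" "V \<noteq> W"
    by auto
  then have "V \<inter> W = {}"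
    using assms unfolding refines_def partition_on_def disjoint_def by blast
  moreover have "{} \<notin> P"
    using assms by (auto simp: refines_def partition_on_def)
  ultimately have "B \<notin> Y" if "B \<in> X" for B
    using that VW(3,4) by (auto simp: blocks_in_def dest: Int_greatest)
  then have "X \<inter> Y = {}"
    by auto
  then show "disjnt X Y"
    by (simp add: disjnt_def)
qed

lemma refines_image_Union:
  assumes P: "partition_on A P" and T: "partition_on P T"
  shows "refines A P (Union ` T)"
proof -
  have UT: "\<Union>T = P" and UP: "\<Union>P = A"
    using assms by (auto simp: partition_on_def)
  have "partition_on A (Union ` T)"
  proof (rule partition_onI)
    show "\<Union>(Union ` T) = A"
      using UT UP by blast
    show "{} \<notin> Union ` T"
    proof
      assume "{} \<in> Union ` T"
      then obtain X where X: "X \<in> T" "\<Union>X = {}"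
        by auto
      then have "X \<noteq> {}" "X \<subseteq> P"
        using T by (auto simp: partition_on_def)
      then show False
        using X(2) P by (auto simp: partition_on_def)
    qed
  next
    fix V W assume "V \<in> Union ` T" "W \<in> Union ` T" "V \<noteq> W"
    then obtain X Y where XY: "X \<in> T" "Y \<in> T" "X \<noteq> Y" "V = \<Union>X" "W = \<Union>Y"
      by auto
    have XP: "X \<subseteq> P" "Y \<subseteq> P"
      using XY(1,2) UT by auto
    have "X \<inter> Y = {}"
      using XY(1-3) T unfolding partition_on_def disjoint_def by blast
    have "B \<inter> C = {}" if "B \<in> X" "C \<in> Y" for B C
    proof -
      have "B \<in> P" "C \<in> P" "B \<noteq> C"
        using that XP \<open>X \<inter> Y = {}\<close> by auto
      then show ?thesis
        using P unfolding partition_on_def disjoint_def by blast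
    qed
    then have "V \<inter> W = {}"
      unfolding XY(4,5) by blast
    then show "disjnt V W"
      by (simp add: disjnt_def)
  qed
  moreover have "\<exists>Y\<in>Union ` T. X \<subseteq> Y" if "X \<in> P" for X
    using that UT by blast
  ultimately show ?thesis
    using P unfolding refines_def by blast
qed

lemma refines_blocks_in_iff:
  assumes "refines A P Q" "refines A P S"
  shows "refines P (blocks_in P ` Q) (blocks_in P ` S) \<longleftrightarrow> refines A Q S"
proof -
  have "partition_on A Q" "partition_on A S"
    using assms by (auto simp: refines_def)
  then show ?thesis
    using partition_on_blocks_in[OF assms(1)] partition_on_blocks_in[OF assms(2)]
    by (auto simp: refines_def blocks_in_subset_iff[OF assms])
qed

lemma inj_on_blocks_in: "refines A P Q \<Longrightarrow> inj_on (blocks_in P) Q"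
  by (metis Union_blocks_in inj_onI)

lemma sum_refines_interval:
  fixes F :: "'a set set \<Rightarrow> 'b :: comm_semiring_1"
  assumes fin: "finite A" and PS: "refines A P S"
  shows "(\<Sum>Q | refines A P Q \<and> refines A Q S. \<Prod>V\<in>Q. F (blocks_in P V)) =
    (\<Prod>W\<in>S. \<Sum>T | partition_on (blocks_in P W) T. \<Prod>X\<in>T. F X)"
proof -
  have P: "partition_on A P" and S: "partition_on A S"
    using PS by (auto simp: refines_def)
  have finP: "finite P"
    using finite_elements[OF fin P] .
  have blU: "blocks_in P ` Union ` T = T" if "partition_on P T" for T
  proof -
    have "blocks_in P (\<Union>X) = X" if "X \<in> T" for X
      using that \<open>partition_on P T\<close> by (intro blocks_in_Union[OF P]) (auto simp: partition_on_def)
    then show ?thesis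
      by (simp add: image_image)
  qed
  have Ubl: "Union ` blocks_in P ` Q = Q" if "refines A P Q" for Q
    using Union_blocks_in[OF that] by (simp add: image_image)
  have "(\<Prod>W\<in>S. \<Sum>T | partition_on (blocks_in P W) T. \<Prod>X\<in>T. F X) =
    (\<Prod>U\<in>blocks_in P ` S. \<Sum>T | partition_on U T. \<Prod>X\<in>T. F X)"
    by (simp add: prod.reindex inj_on_blocks_in[OF PS])
  also have "\<dots> = (\<Sum>T | refines P T (blocks_in P ` S). \<Prod>X\<in>T. F X)"
    by (rule sum_refinements[OF finP partition_on_blocks_in[OF PS], symmetric])
  also have "\<dots> = (\<Sum>Q | refines A P Q \<and> refines A Q S. \<Prod>V\<in>Q. F (blocks_in P V))"
  proof (rule sum.reindex_bij_witness[where i = "(`) (blocks_in P)" and j = "(`) Union"], goal_cases)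
    case (1 T)
    then show ?case
      using blU by (auto simp: refines_def)
  next
    case (2 T)
    then have T: "partition_on P T"
      by (auto simp: refines_def)
    have "refines A P (Union ` T)"
      by (rule refines_image_Union[OF P T])
    moreover have "refines A (Union ` T) S"
      using refines_blocks_in_iff[OF refines_image_Union[OF P T] PS] 2 blU[OF T] by simp
    ultimately show ?case
      by simp
  next
    case (3 Q)
    then show ?case
      using Ubl by simp
  next
    case (4 Q)
    then show ?case
      using refines_blocks_in_iff[OF _ PS] by simp
  next
    case (5 T)
    then have T: "partition_on P T"
      by (auto simp: refines_def)
    have bl: "blocks_in P (\<Union>X) = X" if "X \<in> T" for X
      using that T by (intro blocks_in_Union[OF P]) (auto simp: partition_on_def)
    then have "inj_on Union T"
      by (metis inj_onI)
    then show ?case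
      using bl by (simp add: prod.reindex)
  qed
  finally show ?thesis
    by simp
qed

subsection \<open>The Moebius function\<close>

text \<open>The Moebius function of the partition lattice of a \<open>k\<close>-element set between its least and its
  greatest element; the value at 0 has no meaning.\<close>

definition cycle_weight :: "nat \<Rightarrow> 'a :: comm_ring_1" where
  "cycle_weight k = (-1) ^ (k - 1) * of_nat (fact (k - 1))"

text \<open>Dividing the Moebius values by \<open>k!\<close> leaves \<open>(-1)^(k-1) / k\<close>;
  this is where the logarithm enters.\<close>

lemma egf0_cycle_weight: "egf0 cycle_weight = (fps_ln 1 :: 'a :: field_char_0 fps)"
proof (rule fps_ext)
  fix k show "egf0 cycle_weight $ k = (fps_ln 1 :: 'a fps) $ k"
    by (cases k) (simp_all add: egf0_nth fps_ln_nth cycle_weight_def)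
qed

text \<open>\<open>cycle_weight 0\<close> is 1 and has to be overwritten, since the logarithm series
  has no constant term.\<close>

lemma egf_compose_cycle_weight:
  assumes "W $ 0 = 1"
  shows "egf (cycle_weight(0 := 0)) oo (W - 1) = fps_log W"
  unfolding fps_log_def egf0_cycle_weight[symmetric] egf0_def ..

lemma cycle_weight_div_fact:
  assumes "k > 0"
  shows "cycle_weight k / fact k = ((-1) ^ (k - 1) / of_nat k :: 'a :: field_char_0)"
  using assms by (cases k) (simp_all add: cycle_weight_def del: of_nat_Suc)

text \<open>The coefficients of the exponent of \<open>E\<close>, in the shape in which they are
  compared with logarithms of products over the roots and of the cumulant series.\<close>

lemma egf0_scaled_cycle_weight_nth:
  assumes "k > 0"
  shows "egf0 (\<lambda>k. c * cycle_weight k * f k) $ k =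
    ((-1) ^ (k - 1) / of_nat k * (c * f k) :: 'a :: field_char_0)"
proof -
  have "egf0 (\<lambda>k. c * cycle_weight k * f k) $ k = cycle_weight k / fact k * (c * f k)"
    using assms by (simp add: egf0_nth)
  then show ?thesis
    unfolding cycle_weight_div_fact[OF assms] .
qed

text \<open>By the exponential formula the series of these sums is exp of \<open>ln (1 + x)\<close>,
  that is \<open>1 + x\<close>, which has only two nonzero coefficients.\<close>

lemma sum_partitions_cycle_weight:
  assumes "finite B"
  shows "(\<Sum>T | partition_on B T. \<Prod>X\<in>T. cycle_weight (card X)) =
    (if card B \<le> 1 then 1 else 0 :: 'a :: field_char_0)"
proof -
  have "card B \<le> 1 \<longleftrightarrow> card B = 0 \<or> card B = 1"
    by linarith
  then show ?thesis
    unfolding sum_partitions_exp[OF assms] egf0_cycle_weight fps_exp_compose_ln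
    by (auto simp: fps_X_def)
qed

text \<open>A block of \<open>S\<close> is a nonempty union of blocks of \<open>P\<close>. If it
  contains at most one of them, it equals that block, and antisymmetry of refinement
  applies.\<close>

lemma refines_eq_iff_card_blocks_in:
  assumes "finite A" "refines A P S"
  shows "(\<forall>W\<in>S. card (blocks_in P W) \<le> 1) \<longleftrightarrow> P = S"
proof
  assume le: "\<forall>W\<in>S. card (blocks_in P W) \<le> 1"
  have finP: "finite P"
    using assms finite_elements by (auto simp: refines_def)
  have "W \<in> P" if W: "W \<in> S" for W
  proof -
    have "W \<noteq> {}"
      using W assms(2) by (auto simp: refines_def partition_on_def)
    then have "blocks_in P W \<noteq> {}"
      using Union_blocks_in[OF assms(2) W] by auto
    moreover have fin: "finite (blocks_in P W)"
      using finP by (simp add: blocks_in_def)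
    ultimately have "card (blocks_in P W) = 1"
      using le W by (simp add: card_gt_0_iff Suc_le_eq le_antisym)
    then obtain B where "blocks_in P W = {B}"
      by (auto simp: card_1_singleton_iff)
    then show ?thesis
      using Union_blocks_in[OF assms(2) W] by (auto simp: blocks_in_def)
  qed
  then have "refines A S P"
    using assms(2) by (auto simp: refines_def)
  then show "P = S"
    using assms(2) refines_asym by blast
next
  assume "P = S"
  have "blocks_in P W = {W}" if "W \<in> S" for W
    using blocks_in_Union[of A P "{W}"] that assms(2) \<open>P = S\<close> by (simp add: refines_def)
  then show "\<forall>W\<in>S. card (blocks_in P W) \<le> 1"
    by simp
qed

text \<open>The product weight satisfies the recursion that defines the Moebius function: the sum
  factors over the blocks of \<open>S\<close>, and a factor vanishes as soon as a block of
  \<open>S\<close> contains two blocks of \<open>P\<close>.\<close>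

lemma sum_interval_cycle_weight:
  assumes "finite A" "refines A P S"
  shows "(\<Sum>Q | refines A P Q \<and> refines A Q S. \<Prod>V\<in>Q. cycle_weight (card (blocks_in P V))) =
    (if P = S then 1 else 0 :: 'a :: field_char_0)"
proof -
  have finP: "finite P" and finS: "finite S"
    using assms finite_elements by (auto simp: refines_def)
  have "(\<Sum>Q | refines A P Q \<and> refines A Q S. \<Prod>V\<in>Q. cycle_weight (card (blocks_in P V))) =
    (\<Prod>W\<in>S. \<Sum>T | partition_on (blocks_in P W) T. \<Prod>X\<in>T. cycle_weight (card X) :: 'a)"
    by (rule sum_refines_interval[OF assms])
  also have "\<dots> = (\<Prod>W\<in>S. if card (blocks_in P W) \<le> 1 then 1 else 0)"
    using finP by (intro prod.cong refl sum_partitions_cycle_weight) (simp add: blocks_in_def)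
  also have "\<dots> = (if \<forall>W\<in>S. card (blocks_in P W) \<le> 1 then 1 else 0)"
    using finS by (auto intro: prod.neutral prod_zero)
  finally show ?thesis
    unfolding refines_eq_iff_card_blocks_in[OF assms] .
qed

text \<open>The interval is a product of partition lattices, one for each block of
  \<open>\<sigma>\<close>. Both sides obey the same recursion, so induction along it
  suffices.\<close>

lemma partition_mobius_eq:
  assumes "partition_le n \<pi> \<sigma>"
  shows "of_int (partition_mobius n \<pi> \<sigma>) =
    (\<Prod>W\<in>\<sigma>. cycle_weight (card (blocks_in \<pi> W)) :: 'a :: field_char_0)"
  using assms
proof (induction n \<pi> \<sigma> rule: partition_mobius.induct)
  case (1 n \<pi> \<sigma>)
  let ?f = "\<lambda>\<rho>. \<Prod>W\<in>\<rho>. cycle_weight (card (blocks_in \<pi> W)) :: 'a"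
  let ?I = "{\<rho>. partition_le n \<pi> \<rho> \<and> partition_le n \<rho> \<sigma>}"
  have le: "refines {1..n} \<pi> \<sigma>"
    using 1(2) by (simp add: partition_le_def)
  have sum: "(\<Sum>\<rho>\<in>?I. ?f \<rho>) = (if \<pi> = \<sigma> then 1 else 0)"
    using sum_interval_cycle_weight[OF _ le] by (simp add: partition_le_def)
  have \<sigma>: "\<sigma> \<in> ?I"
    using le by (auto simp: partition_le_def refines_def)
  have finI: "finite ?I"
    by (rule finite_subset[OF _ finitely_many_partition_on[of "{1..n}"]])
      (auto simp: partition_le_def refines_def)
  show ?case
  proof (cases "\<pi> = \<sigma>")
    case True
    have "?I = {\<sigma>}"
      using True \<sigma> refines_asym by (auto simp: partition_le_def)
    then show ?thesis
      using sum True 1(2) by (simp add: partition_mobius.simps[of n \<sigma> \<sigma>])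
  next
    case False
    have "of_int (partition_mobius n \<pi> \<sigma>) =
      - (\<Sum>\<rho> | partition_le n \<pi> \<rho> \<and> partition_le n \<rho> \<sigma> \<and> \<rho> \<noteq> \<sigma>. of_int (partition_mobius n \<pi> \<rho>) :: 'a)"
      using False 1(2) by (subst partition_mobius.simps) simp
    also have "\<dots> = - (\<Sum>\<rho> | partition_le n \<pi> \<rho> \<and> partition_le n \<rho> \<sigma> \<and> \<rho> \<noteq> \<sigma>. ?f \<rho>)"
      using 1(1)[OF _ False] 1(2) by simp
    also have "{\<rho>. partition_le n \<pi> \<rho> \<and> partition_le n \<rho> \<sigma> \<and> \<rho> \<noteq> \<sigma>} = ?I - {\<sigma>}"
      by auto
    \<comment> \<open>The sum over the whole interval is 0, so leaving out the top element gives
      minus its term.\<close>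
    also have "- (\<Sum>\<rho>\<in>?I - {\<sigma>}. ?f \<rho>) = ?f \<sigma>"
      using sum.remove[OF finI \<sigma>, of ?f] sum False by (intro minus_unique) (simp add: add.commute)
    finally show ?thesis .
  qed
qed

lemma partition_mobius_min:
  assumes "\<sigma> \<in> set_partitions n"
  shows "of_int (partition_mobius n (min_partition n) \<sigma>) =
    (\<Prod>V\<in>\<sigma>. cycle_weight (card V) :: 'a :: field_char_0)"
proof -
  have "partition_on {1..n} \<sigma>"
    using assms by (simp add: set_partitions_def)
  then have "partition_le n (min_partition n) \<sigma>"
    using partition_on_singletons[of "{1..n}"]
    by (fastforce simp: partition_le_def refines_def min_partition_def partition_on_def)
  moreover have "card (blocks_in (min_partition n) V) = card V" if "V \<in> \<sigma>" for V
  proof -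
    have "V \<subseteq> {1..n}"
      using that \<open>partition_on {1..n} \<sigma>\<close> by (auto simp: partition_on_def)
    then have "blocks_in (min_partition n) V = (\<lambda>i. {i}) ` V"
      by (auto simp: blocks_in_def min_partition_def)
    then show ?thesis
      by (simp add: card_image)
  qed
  ultimately show ?thesis
    by (simp add: partition_mobius_eq)
qed

text \<open>The single block \<open>{1..n}\<close> contains all blocks of \<open>\<pi>\<close>. It
  is nonempty by \<open>n > 0\<close>, so that \<open>max_partition n\<close> is a
  partition.\<close>

lemma partition_mobius_max:
  assumes "\<pi> \<in> set_partitions n" "n > 0"
  shows "of_int (partition_mobius n \<pi> (max_partition n)) =
    (cycle_weight (card \<pi>) :: 'a :: field_char_0)"
proof -
  have \<pi>: "partition_on {1..n} \<pi>"
    using assms by (simp add: set_partitions_def)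
  then have "partition_le n \<pi> (max_partition n)"
    using partition_on_space[of "{1..n}"] \<open>n > 0\<close>
    by (auto simp: partition_le_def refines_def max_partition_def partition_on_def)
  moreover have "blocks_in \<pi> {1..n} = \<pi>"
    using \<pi> by (auto simp: blocks_in_def partition_on_def)
  ultimately show ?thesis
    by (simp add: partition_mobius_eq max_partition_def)
qed

subsection \<open>The double sum\<close>

lemma double_sum_eq_log:
  fixes u w :: "nat \<Rightarrow> complex"
  assumes fin: "finite A" "A \<noteq> {}" and w: "w 0 = 1"
  shows "(\<Sum>P | partition_on A P. (\<Prod>V\<in>P. u (card V)) *
      (\<Sum>Q | refines A P Q. cycle_weight (card Q) * (\<Prod>V\<in>Q. w (card V)))) =
    fact (card A) * fps_log (Abs_fps (\<lambda>k. w k * (fps_exp 1 oo egf0 u) $ k)) $ card A"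
proof -
  let ?E = "fps_exp 1 oo egf0 u"
  let ?\<P> = "{P. partition_on A P}"
  define W where "W = Abs_fps (\<lambda>k. w k * ?E $ k)"
  have finP: "finite ?\<P>"
    using fin(1) by (rule finitely_many_partition_on)
  have W0: "W $ 0 = 1"
    by (simp add: W_def w)
  \<comment> \<open>The constant coefficient of \<open>W\<close> is \<open>w 0\<close> times that of
    \<open>?E\<close>, hence 1; subtracting it matches the missing value at 0 in
    \<open>egf0\<close>.\<close>
  have W: "egf0 (\<lambda>k. w k * (fact k * ?E $ k)) = W - 1"
    by (rule fps_ext) (auto simp: egf0_nth W_def w)
  \<comment> \<open>After the exchange the sum runs over refinements of \<open>Q\<close>; it factors
    over the blocks, and the exponential formula evaluates each factor.\<close>
  have inner: "(\<Sum>P | refines A P Q. \<Prod>V\<in>P. u (card V)) = (\<Prod>V\<in>Q. fact (card V) * ?E $ card V)"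
    if Q: "Q \<in> ?\<P>" for Q
    using Q fin(1) finite_block[OF _ fin(1)]
    by (auto simp: sum_refinements sum_partitions_exp intro!: prod.cong)
  have "(\<Sum>P\<in>?\<P>. (\<Prod>V\<in>P. u (card V)) *
      (\<Sum>Q | refines A P Q. cycle_weight (card Q) * (\<Prod>V\<in>Q. w (card V)))) =
    (\<Sum>P\<in>?\<P>. \<Sum>Q | Q \<in> ?\<P> \<and> refines A P Q.
      (\<Prod>V\<in>P. u (card V)) * (cycle_weight (card Q) * (\<Prod>V\<in>Q. w (card V))))"
    by (auto simp: sum_distrib_left refines_def intro!: sum.cong)
  also have "\<dots> = (\<Sum>Q\<in>?\<P>. \<Sum>P | P \<in> ?\<P> \<and> refines A P Q.
      (\<Prod>V\<in>P. u (card V)) * (cycle_weight (card Q) * (\<Prod>V\<in>Q. w (card V))))"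
    by (rule sum.swap_restrict[OF finP finP])
  also have "\<dots> = (\<Sum>Q\<in>?\<P>. cycle_weight (card Q) * (\<Prod>V\<in>Q. w (card V)) *
      (\<Sum>P | refines A P Q. \<Prod>V\<in>P. u (card V)))"
    by (auto simp: sum_distrib_left refines_def mult_ac intro!: sum.cong)
  \<comment> \<open>Changing \<open>cycle_weight\<close> at 0 is harmless: \<open>A\<close> is
    nonempty, so every \<open>Q\<close> has a block.\<close>
  also have "\<dots> = (\<Sum>Q\<in>?\<P>. (cycle_weight(0 := 0)) (card Q) *
      (\<Prod>V\<in>Q. w (card V) * (fact (card V) * ?E $ card V)))"
  proof (rule sum.cong[OF refl])
    fix Q assume Q: "Q \<in> ?\<P>"
    then have "finite Q" "Q \<noteq> {}"
      using fin finite_elements by (auto simp: partition_on_def)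
    then show "cycle_weight (card Q) * (\<Prod>V\<in>Q. w (card V)) *
        (\<Sum>P | refines A P Q. \<Prod>V\<in>P. u (card V)) =
      (cycle_weight(0 := 0)) (card Q) * (\<Prod>V\<in>Q. w (card V) * (fact (card V) * ?E $ card V))"
      unfolding inner[OF Q] by (simp add: prod.distrib mult.assoc)
  qed
  also have "\<dots> = fact (card A) * (egf (cycle_weight(0 := 0)) oo (W - 1)) $ card A"
    unfolding W[symmetric] by (rule sum_partitions_compose[OF fin(1), of "cycle_weight(0 := 0)"
        "\<lambda>k. w k * (fact k * ?E $ k)"])
  also have "\<dots> = fact (card A) * fps_log W $ card A"
    unfolding egf_compose_cycle_weight[OF W0] ..
  finally show ?thesis
    by (simp add: W_def)
qed

subsection \<open>The coefficient series of a polynomial\<close>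

text \<open>The generating function of the elementary symmetric polynomials of the roots.\<close>

definition roots_series :: "complex multiset \<Rightarrow> complex fps" where
  "roots_series M = (\<Prod>r\<in>#M. 1 + fps_const r * fps_X)"

lemma roots_series_nth_0 [simp]: "roots_series M $ 0 = 1"
  by (induction M) (simp_all add: roots_series_def)

text \<open>The logarithm is additive over the linear factors, and each root contributes its own
  power.\<close>

lemma fps_log_roots_series:
  assumes "n > 0"
  shows "fps_log (roots_series M) $ n = (-1) ^ (n - 1) * (\<Sum>r\<in>#M. r ^ n) / of_nat n"
proof (induction M)
  case empty
  then show ?case
    by (simp add: roots_series_def)
next
  case (add r M)
  have "roots_series (add_mset r M) = (1 + fps_const r * fps_X) * roots_series M"
    by (simp add: roots_series_def)
  then have "fps_log (roots_series (add_mset r M)) =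
      fps_log (1 + fps_const r * fps_X) + fps_log (roots_series M)"
    by (simp add: fps_log_mult)
  then show ?case
    using add fps_log_linear[OF assms, of r] by (simp add: add_divide_distrib algebra_simps)
qed

text \<open>Reflecting \<open>x - r\<close> gives \<open>1 - r x\<close>, and
  \<open>x \<mapsto> -x\<close> gives \<open>1 + r x\<close>; both operations respect
  products.\<close>

lemma roots_series_eq_reflect_poly:
  "roots_series M = fps_of_poly (reflect_poly (\<Prod>r\<in>#M. [:- r, 1:])) oo - fps_X"
proof (induction M)
  case empty
  then show ?case
    by (simp add: roots_series_def)
next
  case (add r M)
  have "reflect_poly [:- r, 1:] = [:1, - r:]"
    by (rule poly_eqI) (auto simp: coeff_reflect_poly coeff_pCons split: nat.splits)
  then have "fps_of_poly (reflect_poly [:- r, 1:]) oo - fps_X = 1 + fps_const r * fps_X"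
    by (simp add: fps_of_poly_linear' fps_compose_sub_distrib fps_compose_mult_distrib
        flip: fps_const_neg)
  then show ?case
    using add by (simp add: roots_series_def reflect_poly_mult fps_of_poly_mult fps_compose_mult_distrib
        del: mult_pCons_left)
qed

text \<open>Vieta's formulas: a monic complex polynomial is the product of its linear factors,
  reflection reverses the coefficients, and the substitution \<open>-x\<close> supplies the
  sign.\<close>

lemma roots_series_proots_nth:
  assumes "lead_coeff p = 1"
  shows "roots_series (proots p) $ k = (if k \<le> degree p then signed_coeff p k else 0)"
proof -
  have "(\<Prod>r\<in>#proots p. [:- r, 1:]) = p"
    using complex_poly_decompose_multiset[of p] assms by simp
  then show ?thesis
    by (simp add: roots_series_eq_reflect_poly fps_compose_uminus' coeff_reflect_poly signed_coeff_def)
qed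

section \<open>The cumulant series as a normalisation of the root series\<close>

lemma falling_0 [simp]: "falling d 0 = 1"
  by (simp add: falling_def)

lemma falling_nonzero: "k \<le> d \<Longrightarrow> falling d k \<noteq> 0"
  by (auto simp: falling_def)

text \<open>This also covers \<open>k\<close> above the degree, where the coefficient of the root
  series is 0 and the quotient is \<open>0 / 0 = 0\<close>.\<close>

lemma cumulant_series_nth:
  assumes "lead_coeff p = 1"
  shows "cumulant_series p $ k =
    (- of_nat (degree p)) ^ k * (roots_series (proots p) $ k / falling (degree p) k)"
  unfolding cumulant_series_def roots_series_proots_nth[OF assms]
  by (simp add: fps_sum_nth if_distrib[of "\<lambda>x. _ * x"] cong: if_cong)

lemma cumulant_series_nth_0 [simp]:
  assumes "lead_coeff p = 1"
  shows "cumulant_series p $ 0 = 1"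
  by (simp add: cumulant_series_nth[OF assms] falling_def)

text \<open>Coefficient \<open>j - 1\<close> of a derivative is \<open>j\<close> times coefficient
  \<open>j\<close> of the series.\<close>

lemma finite_free_cumulant_eq:
  assumes "j > 0"
  shows "finite_free_cumulant p j =
    - (of_nat j / of_nat (degree p)) * fps_log (cumulant_series p) $ j"
  using assms by (cases j) (simp_all add: finite_free_cumulant_def)

subsection \<open>The moment-cumulant formulas\<close>

text \<open>The power of \<open>c\<close>, the Moebius value from the bottom and
  \<open>block_prod f\<close> merge into one block weight, to which \<open>double_sum_eq_log\<close>
  applies.\<close>

lemma double_sum_set_partitions:
  fixes f w :: "nat \<Rightarrow> complex" and c :: complex
  assumes n: "n > 0" and w: "w 0 = 1"
  shows "(\<Sum>\<sigma>\<in>set_partitions n.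
      c ^ card \<sigma> * of_int (partition_mobius n (min_partition n) \<sigma>) * block_prod f \<sigma> *
      (\<Sum>\<pi> | \<pi> \<in> set_partitions n \<and> partition_le n \<sigma> \<pi>.
        of_int (partition_mobius n \<pi> (max_partition n)) * block_prod w \<pi>)) =
    fact n * fps_log (Abs_fps (\<lambda>k. w k *
      (fps_exp 1 oo egf0 (\<lambda>k. c * cycle_weight k * f k)) $ k)) $ n"
proof -
  have "(\<Sum>\<sigma>\<in>set_partitions n.
      c ^ card \<sigma> * of_int (partition_mobius n (min_partition n) \<sigma>) * block_prod f \<sigma> *
      (\<Sum>\<pi> | \<pi> \<in> set_partitions n \<and> partition_le n \<sigma> \<pi>.
        of_int (partition_mobius n \<pi> (max_partition n)) * block_prod w \<pi>)) =
    (\<Sum>P | partition_on {1..n} P. (\<Prod>V\<in>P. c * cycle_weight (card V) * f (card V)) *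
      (\<Sum>Q | refines {1..n} P Q. cycle_weight (card Q) * (\<Prod>V\<in>Q. w (card V))))"
  proof (intro sum.cong arg_cong2[where f = "(*)"])
    fix \<sigma> assume "\<sigma> \<in> {P. partition_on {1..n} P}"
    then show "c ^ card \<sigma> * of_int (partition_mobius n (min_partition n) \<sigma>) * block_prod f \<sigma> =
        (\<Prod>V\<in>\<sigma>. c * cycle_weight (card V) * f (card V))"
      by (simp add: partition_mobius_min set_partitions_def block_prod_def prod.distrib)
  qed (auto simp: partition_mobius_max n set_partitions_def partition_le_def refines_def block_prod_def)
  then show ?thesis
    using double_sum_eq_log[of "{1..n}" w] n w by simp
qed

lemma inverse_block_prod: "x / block_prod f \<pi> = x * block_prod (\<lambda>k. 1 / f k) \<pi>"
  unfolding block_prod_def prod_dividef by simp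

lemma mobius_max_sign:
  assumes "\<pi> \<in> set_partitions n" "n > 0"
  shows "of_int (partition_mobius n \<pi> (max_partition n)) =
    - ((-1) ^ card \<pi> * fact (card \<pi> - 1) :: complex)"
proof -
  have "\<pi> \<noteq> {}" "finite \<pi>"
    using assms finite_elements[of "{1..n}" \<pi>] by (auto simp: set_partitions_def partition_on_def)
  then have "card \<pi> = Suc (card \<pi> - 1)"
    by (simp add: card_gt_0_iff)
  then have "(-1) ^ card \<pi> = - ((-1) ^ (card \<pi> - 1) :: complex)"
    by (metis mult_minus1 power_Suc)
  then show ?thesis
    by (simp add: partition_mobius_max[OF assms] cycle_weight_def)
qed

lemma cumulant_formula:
  assumes p: "lead_coeff p = 1" and d: "degree p > 0" and n: "n > 0"
  shows "finite_free_cumulant p n = (- of_nat (degree p)) ^ (n - 1) / fact (n - 1) *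
    (\<Sum>\<sigma>\<in>set_partitions n.
      of_nat (degree p) ^ card \<sigma> * of_int (partition_mobius n (min_partition n) \<sigma>) *
      block_prod (poly_moment p) \<sigma> *
      (\<Sum>\<pi> | \<pi> \<in> set_partitions n \<and> partition_le n \<sigma> \<pi>.
        of_int (partition_mobius n \<pi> (max_partition n)) / block_prod (falling (degree p)) \<pi>))"
proof -
  define d :: complex where "d = of_nat (degree p)"
  have d0: "d \<noteq> 0"
    using d by (simp add: d_def)
  define S where "S = roots_series (proots p)"
  define Q where "Q = Abs_fps (\<lambda>k. S $ k / falling (degree p) k)"
  have S0: "S $ 0 = 1" and Q0: "Q $ 0 = 1"
    by (simp_all add: S_def Q_def falling_def)
  \<comment> \<open>\<open>d\<close> times the \<open>k\<close>-th moment is the \<open>k\<close>-th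
    power sum of the roots, so both sides have the coefficients from
    \<open>fps_log_roots_series\<close>.\<close>
  have "egf0 (\<lambda>k. d * cycle_weight k * poly_moment p k) = fps_log S"
  proof (rule fps_ext)
    fix k show "egf0 (\<lambda>k. d * cycle_weight k * poly_moment p k) $ k = fps_log S $ k"
    proof (cases k)
      case (Suc j)
      then show ?thesis
        using d0 egf0_scaled_cycle_weight_nth[of k d "poly_moment p"]
          fps_log_roots_series[of k "proots p"]
        by (simp add: S_def poly_moment_def flip: d_def)
    qed simp
  qed
  then have "fps_exp 1 oo egf0 (\<lambda>k. d * cycle_weight k * poly_moment p k) = S"
    by (simp add: fps_exp_compose_log S0)
  then have sum: "(\<Sum>\<sigma>\<in>set_partitions n.
      d ^ card \<sigma> * of_int (partition_mobius n (min_partition n) \<sigma>) *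
      block_prod (poly_moment p) \<sigma> *
      (\<Sum>\<pi> | \<pi> \<in> set_partitions n \<and> partition_le n \<sigma> \<pi>.
        of_int (partition_mobius n \<pi> (max_partition n)) / block_prod (falling (degree p)) \<pi>)) =
      fact n * fps_log Q $ n"
    unfolding inverse_block_prod
    by (subst double_sum_set_partitions[OF n]) (simp_all add: Q_def)
  \<comment> \<open>The remaining factor \<open>(- d) ^ k\<close> is the substitution
    \<open>x \<mapsto> -d x\<close>.\<close>
  have "cumulant_series p = Q oo (fps_const (- d) * fps_X)"
    unfolding fps_compose_linear
    by (rule fps_ext) (simp add: cumulant_series_nth[OF p] Q_def S_def d_def)
  then have "fps_log (cumulant_series p) = fps_log Q oo (fps_const (- d) * fps_X)"
    by (simp add: fps_log_compose Q0)
  then have "finite_free_cumulant p n = - (of_nat n / d) * ((- d) ^ n * fps_log Q $ n)"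
    by (simp add: finite_free_cumulant_eq[OF n] fps_compose_linear d_def del: fps_const_neg)
  \<comment> \<open>The factor \<open>- 1 / d\<close> lowers the power of \<open>- d\<close> by one,
    and \<open>n\<close> is \<open>fact n / fact (n - 1)\<close>.\<close>
  also have "\<dots> = (- d) ^ (n - 1) / fact (n - 1) * (fact n * fps_log Q $ n)"
    using d0 n by (cases n) (simp_all add: field_simps)
  finally show ?thesis
    unfolding sum[symmetric] d_def .
qed

lemma moment_formula:
  assumes p: "lead_coeff p = 1" and d: "degree p > 0" and n: "n > 0"
  shows "poly_moment p n = (-1) ^ n / (of_nat (degree p) ^ (n + 1) * fact (n - 1)) *
    (\<Sum>\<sigma>\<in>set_partitions n.
      of_nat (degree p) ^ card \<sigma> * of_int (partition_mobius n (min_partition n) \<sigma>) *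
      block_prod (finite_free_cumulant p) \<sigma> *
      (\<Sum>\<pi> | \<pi> \<in> set_partitions n \<and> partition_le n \<sigma> \<pi>.
        - of_int (partition_mobius n \<pi> (max_partition n)) * block_prod (falling (degree p)) \<pi>))"
proof -
  define d :: complex where "d = of_nat (degree p)"
  have d0: "d \<noteq> 0"
    using d by (simp add: d_def)
  define S where "S = roots_series (proots p)"
  define C where "C = cumulant_series p"
  have S0: "S $ 0 = 1" and C0: "C $ 0 = 1"
    using p by (simp_all add: S_def C_def)
  \<comment> \<open>The factor \<open>- k / d\<close> in the cumulant cancels against
    \<open>d / k\<close> and leaves the sign \<open>(-1) ^ k\<close>, which is the substitution
    \<open>x \<mapsto> -x\<close>.\<close>
  have "egf0 (\<lambda>k. d * cycle_weight k * finite_free_cumulant p k) = fps_log C oo - fps_X"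
  proof (rule fps_ext)
    fix k
    show "egf0 (\<lambda>k. d * cycle_weight k * finite_free_cumulant p k) $ k = (fps_log C oo - fps_X) $ k"
    proof (cases k)
      case (Suc j)
      then show ?thesis
        using d0 egf0_scaled_cycle_weight_nth[of k d "finite_free_cumulant p"]
          finite_free_cumulant_eq[of k p]
        by (simp add: fps_compose_uminus' flip: d_def C_def del: of_nat_Suc)
    qed simp
  qed
  also have "\<dots> = fps_log (C oo - fps_X)"
    by (simp add: fps_log_compose C0)
  finally have exp: "fps_exp 1 oo egf0 (\<lambda>k. d * cycle_weight k * finite_free_cumulant p k) =
      C oo - fps_X"
    by (simp add: fps_exp_compose_log C0)
  \<comment> \<open>Up to the degree the falling factorial cancels the one in the cumulant series
    and the two signs cancel; above it both sides are 0.\<close>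
  have "falling (degree p) k * (C oo - fps_X) $ k = d ^ k * S $ k" for k
  proof (cases "k \<le> degree p")
    case True
    have "(-1) ^ k * (- d) ^ k = d ^ k"
      by (simp flip: power_mult_distrib)
    then show ?thesis
      using falling_nonzero[OF True]
      by (simp add: fps_compose_uminus' C_def S_def cumulant_series_nth[OF p] flip: d_def mult.assoc)
  next
    case False
    then show ?thesis
      by (simp add: fps_compose_uminus' C_def S_def cumulant_series_nth[OF p]
          roots_series_proots_nth[OF p])
  qed
  then have scaled: "Abs_fps (\<lambda>k. falling (degree p) k * (C oo - fps_X) $ k) = S oo (fps_const d * fps_X)"
    by (simp add: fps_compose_linear)
  have log: "fps_log (Abs_fps (\<lambda>k. falling (degree p) k * (C oo - fps_X) $ k)) $ n =
      d ^ n * fps_log S $ n"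
    unfolding scaled by (subst fps_log_compose[OF S0]) (simp_all add: fps_compose_linear)
  have sum: "(\<Sum>\<sigma>\<in>set_partitions n.
      d ^ card \<sigma> * of_int (partition_mobius n (min_partition n) \<sigma>) *
      block_prod (finite_free_cumulant p) \<sigma> *
      (\<Sum>\<pi> | \<pi> \<in> set_partitions n \<and> partition_le n \<sigma> \<pi>.
        of_int (partition_mobius n \<pi> (max_partition n)) * block_prod (falling (degree p)) \<pi>)) =
      fact n * (d ^ n * fps_log S $ n)"
    using double_sum_set_partitions[where w = "falling (degree p)" and c = d
        and f = "finite_free_cumulant p", OF n falling_0]
    unfolding exp log .
  have "(\<Sum>r\<in>#proots p. r ^ n) = d * poly_moment p n"
    using d0 by (simp add: poly_moment_def flip: d_def)
  then have "fps_log S $ n = (-1) ^ (n - 1) * d * poly_moment p n / of_nat n"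
    unfolding S_def fps_log_roots_series[OF n] by (simp only: mult.assoc)
  moreover have "fact n = (of_nat n * fact (n - 1) :: complex)"
    using n by (rule fact_reduce)
  \<comment> \<open>The minus sign stems from the negated Moebius values; it cancels against the
    product of the prefactor's sign and that of the logarithm's coefficient.\<close>
  ultimately have "(-1) ^ n / (d ^ (n + 1) * fact (n - 1)) * - (fact n * (d ^ n * fps_log S $ n)) =
      - ((-1) ^ n * (-1) ^ (n - 1)) * poly_moment p n"
    using d0 n by (simp add: field_simps)
  also have "(-1) ^ n * (-1) ^ (n - 1) = (-1 :: complex)"
    using n by (cases n) simp_all
  finally have "poly_moment p n =
      (-1) ^ n / (d ^ (n + 1) * fact (n - 1)) * - (fact n * (d ^ n * fps_log S $ n))"
    by simp
  then show ?thesis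
    unfolding d_def[symmetric] by (simp only: sum sum_negf mult_minus_left mult_minus_right)
qed

theorem theorem4p2:
  fixes d :: nat and p :: "complex poly"
    and m \<kappa> :: "nat \<Rightarrow> complex"
  assumes "d > 0" and "degree p = d" and "lead_coeff p = 1"
  defines "m \<equiv> poly_moment p" and "\<kappa> \<equiv> finite_free_cumulant p"
  shows
    "(\<forall>n\<in>{1..d}.
        \<kappa> n = (- of_nat d) ^ (n - 1) / fact (n - 1) *
          (\<Sum>\<sigma>\<in>set_partitions n.
             of_nat d ^ card \<sigma> * of_int (partition_mobius n (min_partition n) \<sigma>) * block_prod m \<sigma> *
             (\<Sum>\<pi> | \<pi> \<in> set_partitions n \<and> partition_le n \<sigma> \<pi>.
                of_int (partition_mobius n \<pi> (max_partition n)) / block_prod (falling d) \<pi>))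
      \<and> \<kappa> n = (-1) ^ n * of_nat d ^ (n - 1) / fact (n - 1) *
          (\<Sum>\<sigma>\<in>set_partitions n.
             of_nat d ^ card \<sigma> * of_int (partition_mobius n (min_partition n) \<sigma>) * block_prod m \<sigma> *
             (\<Sum>\<pi> | \<pi> \<in> set_partitions n \<and> partition_le n \<sigma> \<pi>.
                (-1) ^ card \<pi> * fact (card \<pi> - 1) / block_prod (falling d) \<pi>)))
   \<and> (\<forall>n\<ge>1.
        m n = (-1) ^ n / (of_nat d ^ (n + 1) * fact (n - 1)) *
          (\<Sum>\<sigma>\<in>set_partitions n.
             of_nat d ^ card \<sigma> * of_int (partition_mobius n (min_partition n) \<sigma>) * block_prod \<kappa> \<sigma> *
             (\<Sum>\<pi> | \<pi> \<in> set_partitions n \<and> partition_le n \<sigma> \<pi>.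
                (- of_int (partition_mobius n \<pi> (max_partition n))) * block_prod (falling d) \<pi>))
      \<and> m n = (-1) ^ n / (of_nat d ^ (n + 1) * fact (n - 1)) *
          (\<Sum>\<sigma>\<in>set_partitions n.
             of_nat d ^ card \<sigma> * of_int (partition_mobius n (min_partition n) \<sigma>) * block_prod \<kappa> \<sigma> *
             (\<Sum>\<pi> | \<pi> \<in> set_partitions n \<and> partition_le n \<sigma> \<pi>.
                (-1) ^ card \<pi> * block_prod (falling d) \<pi> * fact (card \<pi> - 1))))"
proof (intro conjI ballI allI impI)
  have d: "degree p > 0"
    using assms by simp
  note cumulant = cumulant_formula[OF assms(3) d, folded m_def \<kappa>_def, unfolded assms(2)]
  note moment = moment_formula[OF assms(3) d, folded m_def \<kappa>_def, unfolded assms(2)]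
  fix n :: nat
  {
    assume "n \<in> {1..d}"
    then have n: "n > 0"
      by simp
    \<comment> \<open>This sign change of the prefactor absorbs the minus sign in
      \<open>mobius_max_sign\<close>.\<close>
    then have sign: "(-1) ^ n * of_nat d ^ (n - 1) = - ((- of_nat d) ^ (n - 1) :: complex)"
      by (cases n) (simp_all add: power_minus[of "of_nat d"])
    show "\<kappa> n = (- of_nat d) ^ (n - 1) / fact (n - 1) *
          (\<Sum>\<sigma>\<in>set_partitions n.
             of_nat d ^ card \<sigma> * of_int (partition_mobius n (min_partition n) \<sigma>) * block_prod m \<sigma> *
             (\<Sum>\<pi> | \<pi> \<in> set_partitions n \<and> partition_le n \<sigma> \<pi>.
                of_int (partition_mobius n \<pi> (max_partition n)) / block_prod (falling d) \<pi>))"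
      by (rule cumulant[OF n])
    then show "\<kappa> n = (-1) ^ n * of_nat d ^ (n - 1) / fact (n - 1) *
          (\<Sum>\<sigma>\<in>set_partitions n.
             of_nat d ^ card \<sigma> * of_int (partition_mobius n (min_partition n) \<sigma>) * block_prod m \<sigma> *
             (\<Sum>\<pi> | \<pi> \<in> set_partitions n \<and> partition_le n \<sigma> \<pi>.
                (-1) ^ card \<pi> * fact (card \<pi> - 1) / block_prod (falling d) \<pi>))"
      unfolding sign by (simp add: mobius_max_sign n sum_negf cong: conj_cong)
  next
    assume "n \<ge> 1"
    then have n: "n > 0"
      by simp
    show "m n = (-1) ^ n / (of_nat d ^ (n + 1) * fact (n - 1)) *
          (\<Sum>\<sigma>\<in>set_partitions n.
             of_nat d ^ card \<sigma> * of_int (partition_mobius n (min_partition n) \<sigma>) * block_prod \<kappa> \<sigma> *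
             (\<Sum>\<pi> | \<pi> \<in> set_partitions n \<and> partition_le n \<sigma> \<pi>.
                (- of_int (partition_mobius n \<pi> (max_partition n))) * block_prod (falling d) \<pi>))"
      by (rule moment[OF n])
    \<comment> \<open>The prefactor stays as it is: \<open>mobius_max_sign\<close> makes the negated
      Moebius value equal to the explicit summand.\<close>
    then show "m n = (-1) ^ n / (of_nat d ^ (n + 1) * fact (n - 1)) *
          (\<Sum>\<sigma>\<in>set_partitions n.
             of_nat d ^ card \<sigma> * of_int (partition_mobius n (min_partition n) \<sigma>) * block_prod \<kappa> \<sigma> *
             (\<Sum>\<pi> | \<pi> \<in> set_partitions n \<and> partition_le n \<sigma> \<pi>.
                (-1) ^ card \<pi> * block_prod (falling d) \<pi> * fact (card \<pi> - 1)))"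
      by (simp add: mobius_max_sign n mult_ac cong: conj_cong)
  }
qed

end
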